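(* Let $J=[c,d]$ with $d>c>0$, and let $n$ be a positive integer. Let $0<\lambda_1<1$ and $\lambda_k\ge 0$ for $2\le k\le n$ be such that $\sum_{k=1}^{n}\lambda_k=1$. For each $1\le k\le n$ let $\psi_k=\mathrm{id}$ on $J$, let $L_k\ge l_k\ge 0$, let $\Xi_k\in\mathcal{G}(J;l_k,L_k)$, and let $\Psi_k(x)=(\Xi_k(x))^{\lambda_k}$ for $x\in J$. Let $0<\delta<1<M$, and put $K_0=\sum_{k=1}^{n}\lambda_k l_k\delta^{k-1}$ and $K_1=\sum_{k=1}^{n}\lambda_k L_k M^{k-1}$. Suppose further that $$K:=\lambda_1 l_1-\sum_{k=2}^{n}\lambda_k\left(L_k\frac{M^{k-1}-1}{M-1}-l_k\delta^{k-1}\right)>0.$$ If $G\in\mathcal{G}(J;K_1\delta,K_0M)$, then the equation $$\prod_{k=1}^{n}\Psi_k(g^k(\psi_k(x)))=G(x),\qquad x\in J,$$ has a unique solution $g$ in $\mathcal{G}(J;\delta,M)$, and this solution depends continuously on $G$ (that is, the map $G\mapsto g$ from $\mathcal{G}(J;K_1\delta,K_0M)$ to $\mathcal{G}(J;\delta,M)$ is continuous with respect to the uniform norm on $J$).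
   Context: For a self-map $g$ of $J$, $g^k$ denotes the $k$-th iterate: $g^0=\mathrm{id}$, $g^k=g\circ g^{k-1}$. $\mathcal{C}(J,J)$ is the set of continuous maps from $J$ into $J$; the uniform norm is $\|f\|_J=\sup\{|f(x)|:x\in J\}$. For real numbers $\delta,M\ge 0$ and $J=[c,d]$ with $d>c>0$, $$\mathcal{G}(J;\delta,M):=\{g\in\mathcal{C}(J,J): g(c)=c,\ g(d)=d,\ (x/y)^\delta\le g(x)/g(y)\le (x/y)^M\ \text{ for all } x,y\in J \text{ with } x\ge y\}.$$ *)

theory Defs
  imports "HOL-Analysis.Analysis"
begin

(* Self-maps of J are represented by functions that are extensional outside J,
   so that two self-maps of J are equal as HOL functions iff they agree on J. *)
definition cont_self_maps :: "real set \<Rightarrow> (real \<Rightarrow> real) set" where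
  "cont_self_maps J = {f \<in> J \<rightarrow>\<^sub>E J. continuous_on J f}"

definition unif_norm :: "real set \<Rightarrow> (real \<Rightarrow> real) \<Rightarrow> real" where
  "unif_norm J f = (SUP x\<in>J. \<bar>f x\<bar>)"

(* The value 0 off A matters only because Metric_space requires a distance that is
   nonnegative everywhere, whereas SUP over an unbounded set of reals is unspecified. *)
definition unif_dist ::
  "real set \<Rightarrow> (real \<Rightarrow> real) set \<Rightarrow> (real \<Rightarrow> real) \<Rightarrow> (real \<Rightarrow> real) \<Rightarrow> real" where
  "unif_dist J A f g = (if f \<in> A \<and> g \<in> A then unif_norm J (\<lambda>x. f x - g x) else 0)"

definition \<G> :: "real \<Rightarrow> real \<Rightarrow> real \<Rightarrow> real \<Rightarrow> (real \<Rightarrow> real) set" where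
  "\<G> c d \<delta> M = {g \<in> cont_self_maps {c..d}. g c = c \<and> g d = d \<and>
     (\<forall>x\<in>{c..d}. \<forall>y\<in>{c..d}. y \<le> x \<longrightarrow>
        (x / y) powr \<delta> \<le> g x / g y \<and> g x / g y \<le> (x / y) powr M)}"

definition unif_topology :: "real set \<Rightarrow> (real \<Rightarrow> real) set \<Rightarrow> (real \<Rightarrow> real) topology" where
  "unif_topology J A = Metric_space.mtopology A (unif_dist J A)"

(* Without this, mtopology would be the topology of no metric at all. *)
lemma Metric_space_unif_dist:
  assumes cd: "c \<le> d" and A: "A \<subseteq> cont_self_maps {c..d}"
  shows "Metric_space A (unif_dist {c..d} A)"
proof -
  let ?D = "unif_dist {c..d} A"
  have bnd: "\<bar>f x - g x\<bar> \<le> d - c" if "f \<in> A" "g \<in> A" "x \<in> {c..d}" for f g x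
  proof -
    have "f \<in> {c..d} \<rightarrow>\<^sub>E {c..d}" "g \<in> {c..d} \<rightarrow>\<^sub>E {c..d}"
      using that A by (auto simp only: cont_self_maps_def)
    then have "f x \<in> {c..d}" "g x \<in> {c..d}"
      using PiE_mem that(3) by fast+
    then show ?thesis by auto
  qed
  have ub: "\<bar>f x - g x\<bar> \<le> ?D f g" if fgx: "f \<in> A" "g \<in> A" "x \<in> {c..d}" for f g x
  proof -
    have "bdd_above ((\<lambda>x. \<bar>f x - g x\<bar>) ` {c..d})"
      using bnd fgx by (intro bdd_aboveI2[where M = "d - c"])
    then have "\<bar>f x - g x\<bar> \<le> (SUP x\<in>{c..d}. \<bar>f x - g x\<bar>)"
      by (rule cSUP_upper[OF fgx(3)])
    then show ?thesis using fgx by (simp add: unif_dist_def unif_norm_def)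
  qed
  have lub: "?D f g \<le> b"
    if "f \<in> A" "g \<in> A" "\<And>x. x \<in> {c..d} \<Longrightarrow> \<bar>f x - g x\<bar> \<le> b" for f g b
  proof -
    have "(SUP x\<in>{c..d}. \<bar>f x - g x\<bar>) \<le> b"
      by (rule cSUP_least) (use cd that(3) in auto)
    then show ?thesis using that by (simp add: unif_dist_def unif_norm_def)
  qed
  have nn: "0 \<le> ?D f g" for f g
  proof (cases "f \<in> A \<and> g \<in> A")
    case True
    then have "\<bar>f c - g c\<bar> \<le> ?D f g" using ub[of f g c] cd by simp
    then show ?thesis by linarith
  next
    case False
    then show ?thesis by (auto simp: unif_dist_def)
  qed
  show ?thesis
  proof
    show "0 \<le> ?D f g" for f g by (rule nn)
    show "?D f g = ?D g f" for f g
      unfolding unif_dist_def unif_norm_def by (simp add: abs_minus_commute)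
    show "?D f g = 0 \<longleftrightarrow> f = g" if fg: "f \<in> A" "g \<in> A" for f g
    proof
      assume D: "?D f g = 0"
      have "f x = g x" if "x \<in> {c..d}" for x
        using ub[OF fg that] D by simp
      moreover have "f \<in> extensional {c..d}" "g \<in> extensional {c..d}"
        using fg A by (auto simp: cont_self_maps_def PiE_def)
      ultimately show "f = g" by (metis extensionalityI)
    next
      assume "f = g"
      then have "?D f g \<le> 0" by (intro lub) (use fg in auto)
      then show "?D f g = 0" using nn[of f g] by linarith
    qed
    show "?D f h \<le> ?D f g + ?D g h" if "f \<in> A" "g \<in> A" "h \<in> A" for f g h
    proof (rule lub[OF that(1,3)])
      fix x assume x: "x \<in> {c..d}"
      show "\<bar>f x - h x\<bar> \<le> ?D f g + ?D g h"
        using ub[OF that(1,2) x] ub[OF that(2,3) x] by linarith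
    qed
  qed
qed

definition solves_iter_eq ::
  "real set \<Rightarrow> nat \<Rightarrow> (nat \<Rightarrow> real \<Rightarrow> real) \<Rightarrow> (nat \<Rightarrow> real \<Rightarrow> real) \<Rightarrow>
     (real \<Rightarrow> real) \<Rightarrow> (real \<Rightarrow> real) \<Rightarrow> bool" where
  "solves_iter_eq J n \<Psi> \<psi> G g \<longleftrightarrow>
     (\<forall>x\<in>J. (\<Prod>k = 1..n. \<Psi> k ((g ^^ k) (\<psi> k x))) = G x)"

end

theory Submission
  imports Defs
begin

text \<open>
  In the coordinate \<open>t = ln x\<close> the class \<open>\<G>\<close> becomes the class of self-maps of an interval that
  fix the end points and have difference quotients between two given constants, and the equation
  becomes \<open>(\<Sum>k = 1..n. lam k * \<phi> k ((h ^^ k) t)) = H t\<close>. Its left-hand side is \<open>P h (h t)\<close> with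
  \<open>P h u = (\<Sum>k = 1..n. lam k * \<phi> k ((h ^^ (k - 1)) u))\<close>, which has slopes between \<open>K\<^sub>0\<close> and \<open>K\<^sub>1\<close>,
  so solutions are the fixed points of \<open>h \<mapsto> (P h)\<inverse> \<circ> H\<close>. As a function of \<open>h\<close>, \<open>P h\<close> has Lipschitz
  constant \<open>K\<^sub>0 - K\<close>, so this map is a contraction with factor \<open>(K\<^sub>0 - K) / K\<^sub>0 < 1\<close>; the same
  estimate shows that \<open>H \<mapsto> h\<close> has Lipschitz constant \<open>1 / K\<close>.
\<close>

section \<open>Self-maps of an interval with bounded slopes\<close>

text \<open>Additive counterpart of \<open>\<G>\<close> under \<open>t = ln x\<close>. Only values
  on \<open>{a..b}\<close> are constrained, so members are compared pointwise there rather than by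
  equality of functions.\<close>

definition slope_maps :: "real \<Rightarrow> real \<Rightarrow> real \<Rightarrow> real \<Rightarrow> (real \<Rightarrow> real) set" where
  "slope_maps a b p q = {f \<in> {a..b} \<rightarrow> {a..b}. f a = a \<and> f b = b \<and>
     (\<forall>x\<in>{a..b}. \<forall>y\<in>{a..b}. y \<le> x \<longrightarrow> p * (x - y) \<le> f x - f y \<and> f x - f y \<le> q * (x - y))}"

lemma slope_mapsD:
  assumes "f \<in> slope_maps a b p q"
  shows "x \<in> {a..b} \<Longrightarrow> f x \<in> {a..b}" "f a = a" "f b = b"
    and "x \<in> {a..b} \<Longrightarrow> y \<in> {a..b} \<Longrightarrow> y \<le> x \<Longrightarrow> p * (x - y) \<le> f x - f y"
    and "x \<in> {a..b} \<Longrightarrow> y \<in> {a..b} \<Longrightarrow> y \<le> x \<Longrightarrow> f x - f y \<le> q * (x - y)"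
  using assms unfolding slope_maps_def by blast+

text \<open>A nonnegative lower slope makes \<open>f\<close> monotone, and a monotone function that
  fixes both end points maps the interval into itself.\<close>

lemma slope_mapsI:
  assumes "0 \<le> p" "a \<le> b" "f a = a" "f b = b"
    and "\<And>x y. x \<in> {a..b} \<Longrightarrow> y \<in> {a..b} \<Longrightarrow> y \<le> x \<Longrightarrow> p * (x - y) \<le> f x - f y"
    and "\<And>x y. x \<in> {a..b} \<Longrightarrow> y \<in> {a..b} \<Longrightarrow> y \<le> x \<Longrightarrow> f x - f y \<le> q * (x - y)"
  shows "f \<in> slope_maps a b p q"
proof -
  have mono: "f y \<le> f x" if "x \<in> {a..b}" "y \<in> {a..b}" "y \<le> x" for x y
  proof -
    have "0 \<le> p * (x - y)" using that assms(1) by simp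
    then show ?thesis using assms(5)[OF that] by linarith
  qed
  have "f x \<in> {a..b}" if "x \<in> {a..b}" for x
    using mono[of x a] mono[of b x] that assms by simp
  then show ?thesis using assms by (simp add: slope_maps_def)
qed

text \<open>Frees the slope bounds from the order of the two points. As \<open>p\<close> and
  \<open>q\<close> may have any sign here, the upper constant covers both in absolute value.\<close>

lemma slope_maps_abs:
  assumes "f \<in> slope_maps a b p q" "x \<in> {a..b}" "y \<in> {a..b}"
  shows "p * \<bar>x - y\<bar> \<le> \<bar>f x - f y\<bar>" "\<bar>f x - f y\<bar> \<le> max \<bar>p\<bar> \<bar>q\<bar> * \<bar>x - y\<bar>"
proof -
  have *: "p * \<bar>x - y\<bar> \<le> \<bar>f x - f y\<bar> \<and> \<bar>f x - f y\<bar> \<le> max \<bar>p\<bar> \<bar>q\<bar> * \<bar>x - y\<bar>"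
    if xy: "x \<in> {a..b}" "y \<in> {a..b}" "y \<le> x" for x y
  proof -
    let ?m = "max \<bar>p\<bar> \<bar>q\<bar>"
    have "q * (x - y) \<le> ?m * (x - y)" "- ?m * (x - y) \<le> p * (x - y)"
      by (intro mult_right_mono; use xy in linarith)+
    then show ?thesis
      using slope_mapsD(4,5)[OF assms(1) xy] xy by (auto simp: abs_le_iff)
  qed
  show "p * \<bar>x - y\<bar> \<le> \<bar>f x - f y\<bar>" "\<bar>f x - f y\<bar> \<le> max \<bar>p\<bar> \<bar>q\<bar> * \<bar>x - y\<bar>"
    using *[of x y] *[of y x] assms(2,3) by (cases "y \<le> x"; simp add: abs_minus_commute)+
qed

lemma slope_maps_Lipschitz:
  assumes "f \<in> slope_maps a b p q" "0 \<le> p" "p \<le> q" "x \<in> {a..b}" "y \<in> {a..b}"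
  shows "\<bar>f x - f y\<bar> \<le> q * \<bar>x - y\<bar>"
  using slope_maps_abs(2)[OF assms(1,4,5)] assms(2,3) by (simp add: max_def split: if_splits)

lemma slope_maps_continuous:
  assumes "f \<in> slope_maps a b p q"
  shows "continuous_on {a..b} f"
proof (rule lipschitz_on_continuous_on)
  show "(max \<bar>p\<bar> \<bar>q\<bar>)-lipschitz_on {a..b} f"
    using slope_maps_abs(2)[OF assms] by (intro lipschitz_onI) (auto simp: dist_real_def)
qed

text \<open>Intermediate value theorem between the fixed end points. It later provides preimages
  under \<open>P g\<close>.\<close>

lemma slope_maps_surj:
  assumes "f \<in> slope_maps a b p q" "y \<in> {a..b}"
  shows "\<exists>x\<in>{a..b}. f x = y"
  using IVT'[of f a y b] slope_mapsD(2,3)[OF assms(1)] slope_maps_continuous[OF assms(1)] assms(2)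
  by auto

text \<open>The inner map is monotone because \<open>0 \<le> p'\<close>, so the ordered slope bounds
  of \<open>f\<close> apply to its values and the slopes multiply.\<close>

lemma slope_maps_compose:
  assumes f: "f \<in> slope_maps a b p q" and g: "g \<in> slope_maps a b p' q'"
    and "0 \<le> p" "p \<le> q" "0 \<le> p'"
  shows "(\<lambda>x. f (g x)) \<in> slope_maps a b (p * p') (q * q')"
proof -
  have "p * p' * (x - y) \<le> f (g x) - f (g y) \<and> f (g x) - f (g y) \<le> q * q' * (x - y)"
    if xy: "x \<in> {a..b}" "y \<in> {a..b}" "y \<le> x" for x y
  proof -
    note g1 = slope_mapsD(4,5)[OF g xy]
    have "0 \<le> p' * (x - y)" using xy assms by simp
    then have le: "g y \<le> g x" using g1 by linarith
    note gx = slope_mapsD(1)[OF g xy(1)] and gy = slope_mapsD(1)[OF g xy(2)]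
    have "p * (p' * (x - y)) \<le> p * (g x - g y)" "q * (g x - g y) \<le> q * (q' * (x - y))"
      by (intro mult_left_mono g1; use assms in linarith)+
    then show ?thesis
      using slope_mapsD(4,5)[OF f gx gy le] by (simp add: mult.assoc)
  qed
  then show ?thesis
    using slope_mapsD(1-3)[OF f] slope_mapsD(1-3)[OF g] unfolding slope_maps_def
    by (auto simp del: atLeastAtMost_iff)
qed

lemma slope_maps_id: "p \<le> 1 \<Longrightarrow> 1 \<le> q \<Longrightarrow> (\<lambda>x. x) \<in> slope_maps a b p q"
  unfolding slope_maps_def by (auto simp: mult_le_cancel_right1 mult_le_cancel_right2)

lemma slope_maps_funpow:
  assumes "g \<in> slope_maps a b p q" "0 \<le> p" "p \<le> q"
  shows "(g ^^ k) \<in> slope_maps a b (p ^ k) (q ^ k)"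
proof (induction k)
  case 0
  show ?case using slope_maps_id[of 1 1 a b] by (simp add: id_def)
next
  case (Suc k)
  show ?case
    using slope_maps_compose[OF assms(1) Suc assms(2,3)] assms(2) by (simp add: comp_def)
qed

text \<open>Slope bounds average with the weights; total weight 1 is what keeps the end points
  fixed.\<close>

lemma slope_maps_convex_comb:
  fixes w p q :: "'i \<Rightarrow> real"
  assumes f: "\<And>k. k \<in> I \<Longrightarrow> f k \<in> slope_maps a b (p k) (q k)"
    and w: "\<And>k. k \<in> I \<Longrightarrow> 0 \<le> w k" "(\<Sum>k\<in>I. w k) = 1"
    and p: "\<And>k. k \<in> I \<Longrightarrow> 0 \<le> p k" and "a \<le> b"
  shows "(\<lambda>x. \<Sum>k\<in>I. w k * f k x) \<in> slope_maps a b (\<Sum>k\<in>I. w k * p k) (\<Sum>k\<in>I. w k * q k)"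
proof (rule slope_mapsI)
  show "0 \<le> (\<Sum>k\<in>I. w k * p k)" by (intro sum_nonneg mult_nonneg_nonneg w p)
  show "a \<le> b" by fact
  have "(\<Sum>k\<in>I. w k * f k a) = (\<Sum>k\<in>I. w k * a)" "(\<Sum>k\<in>I. w k * f k b) = (\<Sum>k\<in>I. w k * b)"
    using slope_mapsD(2,3)[OF f] by (intro sum.cong; simp)+
  then show "(\<Sum>k\<in>I. w k * f k a) = a" "(\<Sum>k\<in>I. w k * f k b) = b"
    by (simp_all add: w flip: sum_distrib_right)
  fix x y assume xy: "x \<in> {a..b}" "y \<in> {a..b}" "y \<le> x"
  have *: "w k * (p k * (x - y)) \<le> w k * (f k x - f k y)"
    "w k * (f k x - f k y) \<le> w k * (q k * (x - y))" if "k \<in> I" for k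
    by (intro mult_left_mono slope_mapsD[OF f[OF that]] xy w(1)[OF that])+
  show "(\<Sum>k\<in>I. w k * p k) * (x - y) \<le> (\<Sum>k\<in>I. w k * f k x) - (\<Sum>k\<in>I. w k * f k y)"
    using sum_mono[OF *(1)]
    by (simp add: sum_distrib_right mult.assoc right_diff_distrib sum_subtractf)
  show "(\<Sum>k\<in>I. w k * f k x) - (\<Sum>k\<in>I. w k * f k y) \<le> (\<Sum>k\<in>I. w k * q k) * (x - y)"
    using sum_mono[OF *(2)]
    by (simp add: sum_distrib_right mult.assoc right_diff_distrib sum_subtractf)
qed

text \<open>All defining conditions are equations or weak inequalities between finitely many values,
  so they survive pointwise limits. This replaces completeness in the fixed-point argument.\<close>

lemma slope_maps_limit:
  assumes s: "\<And>i. s i \<in> slope_maps a b p q" and lim: "\<And>x. x \<in> {a..b} \<Longrightarrow> (\<lambda>i. s i x) \<longlonglongrightarrow> f x"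
    and "0 \<le> p" "a \<le> b"
  shows "f \<in> slope_maps a b p q"
proof (rule slope_mapsI)
  show "f a = a"
    by (rule LIMSEQ_unique[OF lim]) (use assms(4) slope_mapsD(2)[OF s] in auto)
  show "f b = b"
    by (rule LIMSEQ_unique[OF lim]) (use assms(4) slope_mapsD(3)[OF s] in auto)
  fix x y assume xy: "x \<in> {a..b}" "y \<in> {a..b}" "y \<le> x"
  have "(\<lambda>i. s i x - s i y) \<longlonglongrightarrow> f x - f y" by (intro tendsto_diff lim xy)
  then show "p * (x - y) \<le> f x - f y" "f x - f y \<le> q * (x - y)"
    using slope_mapsD(4,5)[OF s xy] by (blast intro: LIMSEQ_le_const LIMSEQ_le_const2)+
qed (use assms in auto)

text \<open>With \<open>u\<close> and \<open>v\<close> the \<open>k\<close>-th iterates,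
  \<open>g u - h v\<close> splits into \<open>g u - g v\<close>, at most \<open>q\<close> times the
  previous error, and \<open>g v - h v\<close>, at most \<open>e\<close>. This recursion produces
  the geometric sum.\<close>

lemma funpow_diff_le:
  assumes g: "g \<in> slope_maps a b p q" and h: "h \<in> slope_maps a b p q" and pq: "0 \<le> p" "p \<le> q"
    and e: "\<And>x. x \<in> {a..b} \<Longrightarrow> \<bar>g x - h x\<bar> \<le> e" and x: "x \<in> {a..b}"
  shows "\<bar>(g ^^ k) x - (h ^^ k) x\<bar> \<le> (\<Sum>i<k. q ^ i) * e"
proof (induction k)
  case (Suc k)
  let ?u = "(g ^^ k) x" and ?v = "(h ^^ k) x"
  have u: "?u \<in> {a..b}" and v: "?v \<in> {a..b}"
    using slope_mapsD(1)[OF slope_maps_funpow[OF _ pq] x] g h by blast+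
  have "\<bar>g ?u - g ?v\<bar> \<le> q * \<bar>?u - ?v\<bar>" by (rule slope_maps_Lipschitz[OF g pq u v])
  also have "\<dots> \<le> q * ((\<Sum>i<k. q ^ i) * e)"
    by (intro mult_left_mono Suc) (use pq in linarith)
  finally have "\<bar>g ?u - h ?v\<bar> \<le> q * ((\<Sum>i<k. q ^ i) * e) + e" using e[OF v] by linarith
  also have "\<dots> = (\<Sum>i<Suc k. q ^ i) * e"
    by (simp add: sum.lessThan_Suc_shift sum_distrib_left algebra_simps del: sum.lessThan_Suc)
  finally show ?case by simp
qed simp

text \<open>Banach's fixed-point theorem with the supremum distance replaced by arbitrary pointwise
  bounds \<open>e\<close> on \<open>J\<close>. Members of \<open>A\<close> may differ outside
  \<open>J\<close>, so the fixed point is obtained only pointwise on \<open>J\<close>.\<close>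

lemma uniform_contraction_fixpoint:
  fixes T :: "('a \<Rightarrow> real) \<Rightarrow> 'a \<Rightarrow> real"
  assumes f0: "f0 \<in> A" and T: "\<And>f. f \<in> A \<Longrightarrow> T f \<in> A"
    and q: "0 \<le> q" "q < 1"
    and bounded: "\<And>f g x. f \<in> A \<Longrightarrow> g \<in> A \<Longrightarrow> x \<in> J \<Longrightarrow> \<bar>f x - g x\<bar> \<le> B"
    and contr: "\<And>f g e x. f \<in> A \<Longrightarrow> g \<in> A \<Longrightarrow> (\<And>y. y \<in> J \<Longrightarrow> \<bar>f y - g y\<bar> \<le> e) \<Longrightarrow> x \<in> J
      \<Longrightarrow> \<bar>T f x - T g x\<bar> \<le> q * e"
    and closed: "\<And>s f. (\<And>i. s i \<in> A) \<Longrightarrow> (\<And>x. x \<in> J \<Longrightarrow> (\<lambda>i. s i x) \<longlonglongrightarrow> f x) \<Longrightarrow> f \<in> A"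
  obtains f where "f \<in> A" "\<And>x. x \<in> J \<Longrightarrow> T f x = f x"
proof -
  define s where "s i = (T ^^ i) f0" for i
  have sA: "s i \<in> A" for i
    by (induction i) (auto simp: s_def f0 T)
  have sS: "s (Suc i) = T (s i)" for i by (simp add: s_def)
  \<comment> \<open>Applying \<open>T\<close> to both sequences \<open>i\<close> times shrinks the
    initial bound \<open>B\<close> by \<open>q ^ i\<close>, uniformly in \<open>j\<close>; no
    summation of successive differences arises.\<close>
  have step: "\<bar>s (i + j) x - s i x\<bar> \<le> q ^ i * B" if "x \<in> J" for i j x
    using that
  proof (induction i arbitrary: x)
    case 0
    then show ?case using bounded[OF sA sA] by simp
  next
    case (Suc i)
    show ?case using contr[OF sA sA Suc.IH Suc.prems] by (simp add: sS mult.assoc)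
  qed
  have q0: "(\<lambda>i. q ^ i * C) \<longlonglongrightarrow> 0" for C
    using tendsto_mult[OF LIMSEQ_power_zero[of q] tendsto_const[of C]] q by simp
  have "\<exists>y. (\<lambda>i. s i x) \<longlonglongrightarrow> y" if x: "x \<in> J" for x
  proof -
    have "Cauchy (\<lambda>i. s i x)"
      unfolding Cauchy_altdef2
    proof (intro allI impI)
      fix e :: real assume "0 < e"
      then obtain N where N: "q ^ N * B < e"
        using order_tendstoD(2)[OF q0[of B]] unfolding eventually_sequentially by blast
      have "dist (s n x) (s N x) < e" if "n \<ge> N" for n
        using step[OF x, of N "n - N"] N that by (simp add: dist_real_def)
      then show "\<exists>N. \<forall>n\<ge>N. dist (s n x) (s N x) < e" by blast
    qed
    then show ?thesis using Cauchy_convergent convergent_def by blast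
  qed
  then obtain f where f: "\<And>x. x \<in> J \<Longrightarrow> (\<lambda>i. s i x) \<longlonglongrightarrow> f x" by metis
  have fA: "f \<in> A" by (rule closed[OF sA f])
  \<comment> \<open>Let \<open>j\<close> tend to infinity in \<open>step\<close>.\<close>
  have near: "\<bar>f x - s i x\<bar> \<le> q ^ i * B" if x: "x \<in> J" for i x
  proof (rule LIMSEQ_le_const2)
    show "(\<lambda>j. \<bar>s (i + j) x - s i x\<bar>) \<longlonglongrightarrow> \<bar>f x - s i x\<bar>"
      using LIMSEQ_ignore_initial_segment[OF f[OF x], of i]
      by (intro tendsto_intros) (simp add: add.commute)
  qed (use step[OF x] in blast)
  have "T f x = f x" if x: "x \<in> J" for x
  proof (rule LIMSEQ_unique)
    show "(\<lambda>i. s (Suc i) x) \<longlonglongrightarrow> f x" using LIMSEQ_Suc[OF f[OF x]] .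
    \<comment> \<open>Contraction applied to \<open>near\<close> shows that the shifted sequence
      tends to \<open>T f x\<close> as well as to \<open>f x\<close>.\<close>
    have "(\<lambda>i. s (Suc i) x - T f x) \<longlonglongrightarrow> 0"
    proof (rule Lim_null_comparison[OF always_eventually q0[of "q * B"]], rule allI)
      fix i
      show "norm (s (Suc i) x - T f x) \<le> q ^ i * (q * B)"
        using contr[OF fA sA near x, of i] by (simp add: sS abs_minus_commute algebra_simps)
    qed
    then show "(\<lambda>i. s (Suc i) x) \<longlonglongrightarrow> T f x" by (simp add: LIM_zero_iff)
  qed
  then show ?thesis using that fA by blast
qed

section \<open>The equation in logarithmic coordinates\<close>

text \<open>Here \<open>a\<close>, \<open>b\<close> stand for \<open>ln c\<close>,
  \<open>ln d\<close>, while \<open>p\<close>, \<open>q\<close>, \<open>w\<close> stand for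
  \<delta>, \<open>M\<close>, \<open>lam\<close>. The number \<open>S\<close> is a Lipschitz
  constant of \<open>g \<mapsto> P g\<close>, and \<open>K\<^sub>0 - S\<close> is the
  \<open>K\<close> of the theorem.\<close>

locale additive_iter_eq =
  fixes a b p q :: real and n :: nat and w l L :: "nat \<Rightarrow> real" and \<phi> :: "nat \<Rightarrow> real \<Rightarrow> real"
    and K\<^sub>0 K\<^sub>1 S :: real
  assumes ab: "a < b" and p: "0 \<le> p" "p \<le> 1" and q: "1 \<le> q"
    and w_nonneg: "\<And>k. k \<in> {1..n} \<Longrightarrow> 0 \<le> w k" and w_sum: "(\<Sum>k = 1..n. w k) = 1"
    and lL: "\<And>k. k \<in> {1..n} \<Longrightarrow> 0 \<le> l k" "\<And>k. k \<in> {1..n} \<Longrightarrow> l k \<le> L k"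
    and \<phi>: "\<And>k. k \<in> {1..n} \<Longrightarrow> \<phi> k \<in> slope_maps a b (l k) (L k)"
    and K0_def: "K\<^sub>0 = (\<Sum>k = 1..n. w k * (l k * p ^ (k - 1)))"
    and K1_def: "K\<^sub>1 = (\<Sum>k = 1..n. w k * (L k * q ^ (k - 1)))"
    and S_def: "S = (\<Sum>k = 1..n. w k * (L k * (\<Sum>i<k - 1. q ^ i)))"
    and S_less: "S < K\<^sub>0"
begin

definition P :: "(real \<Rightarrow> real) \<Rightarrow> real \<Rightarrow> real" where
  "P g u = (\<Sum>k = 1..n. w k * \<phi> k ((g ^^ (k - 1)) u))"

lemma P_apply: "P g (g x) = (\<Sum>k = 1..n. w k * \<phi> k ((g ^^ k) x))"
  unfolding P_def
proof (rule sum.cong)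
  fix k assume "k \<in> {1..n}"
  then obtain j where "k = Suc j" by (cases k) auto
  then show "w k * \<phi> k ((g ^^ (k - 1)) (g x)) = w k * \<phi> k ((g ^^ k) x)"
    by (simp add: funpow_swap1)
qed simp

lemma pq: "p \<le> q"
  using p q by linarith

lemma S_nonneg: "0 \<le> S"
  unfolding S_def using lL q by (intro sum_nonneg mult_nonneg_nonneg w_nonneg) force+

lemma K0_pos: "0 < K\<^sub>0"
  using S_nonneg S_less by linarith

lemma K0_le_K1: "K\<^sub>0 \<le> K\<^sub>1"
  unfolding K0_def K1_def
proof (intro sum_mono mult_left_mono w_nonneg)
  fix k assume k: "k \<in> {1..n}"
  show "l k * p ^ (k - 1) \<le> L k * q ^ (k - 1)"
    using lL[OF k] p pq by (intro mult_mono power_mono) auto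
qed

text \<open>The \<open>k\<close>-th summand composes \<open>\<phi> k\<close> with
  \<open>k - 1\<close> iterates of \<open>g\<close>, so its slopes lie between
  \<open>l k * p ^ (k - 1)\<close> and \<open>L k * q ^ (k - 1)\<close>; the weights
  \<open>w\<close> average these bounds.\<close>

lemma P_slope:
  assumes "g \<in> slope_maps a b p q"
  shows "P g \<in> slope_maps a b K\<^sub>0 K\<^sub>1"
  unfolding P_def K0_def K1_def
proof (rule slope_maps_convex_comb)
  fix k assume k: "k \<in> {1..n}"
  show "(\<lambda>u. \<phi> k ((g ^^ (k - 1)) u)) \<in> slope_maps a b (l k * p ^ (k - 1)) (L k * q ^ (k - 1))"
    using p by (intro slope_maps_compose \<phi>[OF k] slope_maps_funpow assms pq lL[OF k]) auto
  show "0 \<le> l k * p ^ (k - 1)" using lL[OF k] p by simp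
qed (use w_nonneg w_sum ab in auto)

text \<open>Each summand contributes its weight, the Lipschitz constant \<open>L k\<close> and the
  error of \<open>k - 1\<close> iterates. For \<open>k = 1\<close> no iterate occurs and the
  geometric sum is empty.\<close>

lemma P_diff:
  assumes g: "g \<in> slope_maps a b p q" and h: "h \<in> slope_maps a b p q"
    and e: "\<And>x. x \<in> {a..b} \<Longrightarrow> \<bar>g x - h x\<bar> \<le> e" and u: "u \<in> {a..b}"
  shows "\<bar>P g u - P h u\<bar> \<le> S * e"
proof -
  have "\<bar>P g u - P h u\<bar> =
      \<bar>\<Sum>k = 1..n. w k * (\<phi> k ((g ^^ (k - 1)) u) - \<phi> k ((h ^^ (k - 1)) u))\<bar>"
    by (simp add: P_def right_diff_distrib sum_subtractf)
  also have "\<dots> \<le> (\<Sum>k = 1..n. w k * (L k * ((\<Sum>i<k - 1. q ^ i) * e)))"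
  proof (intro order.trans[OF sum_abs] sum_mono)
    fix k assume k: "k \<in> {1..n}"
    let ?x = "(g ^^ (k - 1)) u" and ?y = "(h ^^ (k - 1)) u"
    have "?x \<in> {a..b}" "?y \<in> {a..b}"
      using slope_mapsD(1)[OF slope_maps_funpow[OF _ p(1) pq] u] g h by blast+
    then have "\<bar>\<phi> k ?x - \<phi> k ?y\<bar> \<le> L k * \<bar>?x - ?y\<bar>"
      using slope_maps_Lipschitz[OF \<phi>[OF k] lL[OF k]] by blast
    also have "\<dots> \<le> L k * ((\<Sum>i<k - 1. q ^ i) * e)"
      using lL[OF k] by (intro mult_left_mono funpow_diff_le[OF g h p(1) pq e u]) auto
    finally show "\<bar>w k * (\<phi> k ?x - \<phi> k ?y)\<bar> \<le> w k * (L k * ((\<Sum>i<k - 1. q ^ i) * e))"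
      using w_nonneg[OF k] by (simp add: abs_mult mult_left_mono)
  qed
  also have "\<dots> = S * e" by (simp add: S_def sum_distrib_right mult.assoc)
  finally show ?thesis .
qed

text \<open>Start from \<open>K\<^sub>0 * \<bar>u - v\<bar> \<le> \<bar>P g u - P g v\<bar>\<close>
  and replace \<open>P g v\<close> by \<open>P h v\<close> at the cost \<open>S * e\<close>. The
  estimate serves both the contraction and the stability bound.\<close>

lemma P_inverse_diff:
  assumes g: "g \<in> slope_maps a b p q" and h: "h \<in> slope_maps a b p q"
    and e: "\<And>x. x \<in> {a..b} \<Longrightarrow> \<bar>g x - h x\<bar> \<le> e" and uv: "u \<in> {a..b}" "v \<in> {a..b}"
  shows "K\<^sub>0 * \<bar>u - v\<bar> \<le> S * e + \<bar>P g u - P h v\<bar>"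
  using slope_maps_abs(1)[OF P_slope[OF g] uv] P_diff[OF g h e uv(2)] by linarith

text \<open>At a point \<open>z\<close> where \<open>\<bar>g - h\<bar>\<close> is largest, the bound
  \<open>e\<close> equals the difference itself, so the term \<open>S * e\<close> can be absorbed on
  the left.\<close>

lemma stability:
  assumes g: "g \<in> slope_maps a b p q" and h: "h \<in> slope_maps a b p q"
    and eta: "\<And>x. x \<in> {a..b} \<Longrightarrow> \<bar>P g (g x) - P h (h x)\<bar> \<le> \<eta>" and x: "x \<in> {a..b}"
  shows "(K\<^sub>0 - S) * \<bar>g x - h x\<bar> \<le> \<eta>"
proof -
  have "continuous_on {a..b} (\<lambda>x. \<bar>g x - h x\<bar>)"
    using g h by (intro continuous_intros slope_maps_continuous)
  then obtain z where z: "z \<in> {a..b}" and max: "\<And>y. y \<in> {a..b} \<Longrightarrow> \<bar>g y - h y\<bar> \<le> \<bar>g z - h z\<bar>"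
    using continuous_attains_sup[of "{a..b}" "\<lambda>x. \<bar>g x - h x\<bar>"] ab by auto
  have "K\<^sub>0 * \<bar>g z - h z\<bar> \<le> S * \<bar>g z - h z\<bar> + \<bar>P g (g z) - P h (h z)\<bar>"
    using slope_mapsD(1)[OF g z] slope_mapsD(1)[OF h z] by (intro P_inverse_diff[OF g h max])
  then have "(K\<^sub>0 - S) * \<bar>g z - h z\<bar> \<le> \<eta>"
    using eta[OF z] by (simp add: left_diff_distrib)
  moreover have "(K\<^sub>0 - S) * \<bar>g x - h x\<bar> \<le> (K\<^sub>0 - S) * \<bar>g z - h z\<bar>"
    using max[OF x] S_less by (intro mult_left_mono) auto
  ultimately show ?thesis by linarith
qed

text \<open>The slopes allowed for \<open>H\<close> are such that division by the slopes of
  \<open>P g\<close>, which lie between \<open>K\<^sub>0\<close> and \<open>K\<^sub>1\<close>,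
  leaves slopes between \<open>p\<close> and \<open>q\<close>. Hence the class is mapped into
  itself.\<close>

lemma existence:
  assumes H: "H \<in> slope_maps a b (K\<^sub>1 * p) (K\<^sub>0 * q)"
  obtains g where "g \<in> slope_maps a b p q" "\<And>x. x \<in> {a..b} \<Longrightarrow> P g (g x) = H x"
proof -
  let ?A = "slope_maps a b p q"
  \<comment> \<open>\<open>T g\<close> is the inverse of \<open>P g\<close> applied to
    \<open>H\<close>; the choice is unique because \<open>P g\<close> has slopes at least
    \<open>K\<^sub>0 > 0\<close>.\<close>
  define T where "T g x = (SOME u. u \<in> {a..b} \<and> P g u = H x)" for g x
  have T: "T g x \<in> {a..b}" "P g (T g x) = H x" if "g \<in> ?A" "x \<in> {a..b}" for g x
  proof -
    have "\<exists>u. u \<in> {a..b} \<and> P g u = H x"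
      using slope_maps_surj[OF P_slope[OF that(1)] slope_mapsD(1)[OF H that(2)]] by blast
    from someI_ex[OF this] show "T g x \<in> {a..b}" "P g (T g x) = H x" by (auto simp: T_def)
  qed
  have K1: "0 < K\<^sub>1" using K0_pos K0_le_K1 by linarith
  have TA: "T g \<in> ?A" if g: "g \<in> ?A" for g
  proof (rule slope_mapsI)
    note Pg = P_slope[OF g]
    have inj: "u = v" if "u \<in> {a..b}" "v \<in> {a..b}" "P g u = P g v" for u v
      using slope_maps_abs(1)[OF Pg that(1,2)] that(3) K0_pos by (simp add: mult_le_0_iff)
    have a: "a \<in> {a..b}" and b: "b \<in> {a..b}" using ab by auto
    show "T g a = a"
      by (rule inj[OF T(1)[OF g a] a]) (simp add: T(2)[OF g a] slope_mapsD(2)[OF H] slope_mapsD(2)[OF Pg])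
    show "T g b = b"
      by (rule inj[OF T(1)[OF g b] b]) (simp add: T(2)[OF g b] slope_mapsD(3)[OF H] slope_mapsD(3)[OF Pg])
    fix x y assume xy: "x \<in> {a..b}" "y \<in> {a..b}" "y \<le> x"
    note Tx = T[OF g xy(1)] and Ty = T[OF g xy(2)] and Hxy = slope_mapsD(4,5)[OF H xy]
    have "0 \<le> K\<^sub>1 * p * (x - y)" using K1 p xy by simp
    then have Hle: "H y \<le> H x" using Hxy by linarith
    \<comment> \<open>\<open>P g\<close> is strictly increasing and \<open>H\<close> is monotone.
      This order is needed before the slope bounds of \<open>P g\<close> can be used at
      \<open>T g x\<close> and \<open>T g y\<close>.\<close>
    have le: "T g y \<le> T g x"
    proof (rule ccontr)
      assume "\<not> T g y \<le> T g x"
      moreover from this have "0 < K\<^sub>0 * (T g y - T g x)" using K0_pos by simp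
      ultimately show False
        using slope_mapsD(4)[OF Pg Ty(1) Tx(1)] Hle Tx(2) Ty(2) by linarith
    qed
    \<comment> \<open>\<open>H x - H y\<close> is also the increment of \<open>P g\<close> between
      \<open>T g y\<close> and \<open>T g x\<close>; compare the slope bounds of \<open>H\<close>
      with those of \<open>P g\<close>.\<close>
    have "K\<^sub>1 * (p * (x - y)) \<le> K\<^sub>1 * (T g x - T g y)" "K\<^sub>0 * (T g x - T g y) \<le> K\<^sub>0 * (q * (x - y))"
      using slope_mapsD(4,5)[OF Pg Tx(1) Ty(1) le] Hxy Tx(2) Ty(2) by (simp_all only: mult.assoc)
    then show "p * (x - y) \<le> T g x - T g y" "T g x - T g y \<le> q * (x - y)"
      using K0_pos K1 by (simp_all only: mult_le_cancel_left_pos)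
  qed (use p ab in auto)
  obtain g where g: "g \<in> ?A" and fixpt: "\<And>x. x \<in> {a..b} \<Longrightarrow> T g x = g x"
  proof (rule uniform_contraction_fixpoint[of "\<lambda>x. x" ?A T "S / K\<^sub>0" "{a..b}" "b - a"])
    show "(\<lambda>x. x) \<in> ?A" by (rule slope_maps_id[OF p(2) q])
    show "0 \<le> S / K\<^sub>0" "S / K\<^sub>0 < 1" using K0_pos S_nonneg S_less by auto
    show "\<bar>f x - g x\<bar> \<le> b - a" if "f \<in> ?A" "g \<in> ?A" "x \<in> {a..b}" for f g x
      using slope_mapsD(1)[OF that(1,3)] slope_mapsD(1)[OF that(2,3)] by auto
    \<comment> \<open>Both \<open>P f (T f x)\<close> and \<open>P g (T g x)\<close> equal
      \<open>H x\<close>, so the last term of \<open>P_inverse_diff\<close> vanishes.\<close>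
    show "\<bar>T f x - T g x\<bar> \<le> S / K\<^sub>0 * e"
      if "f \<in> ?A" "g \<in> ?A" "\<And>y. y \<in> {a..b} \<Longrightarrow> \<bar>f y - g y\<bar> \<le> e" "x \<in> {a..b}" for f g e x
      using P_inverse_diff[OF that(1,2,3) T(1)[OF that(1,4)] T(1)[OF that(2,4)]] K0_pos
      by (simp add: T(2)[OF that(1,4)] T(2)[OF that(2,4)] field_simps)
    show "f \<in> ?A" if "\<And>i. s i \<in> ?A" "\<And>x. x \<in> {a..b} \<Longrightarrow> (\<lambda>i. s i x) \<longlonglongrightarrow> f x" for s f
      by (rule slope_maps_limit[OF that p(1) less_imp_le[OF ab]])
  qed (rule TA that, assumption+)+
  have "P g (g x) = H x" if "x \<in> {a..b}" for x
    using T(2)[OF g that] fixpt[OF that] by simp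
  then show ?thesis using that g by blast
qed

end

section \<open>Transfer to the logarithmic coordinate\<close>

lemma powr_ratio_le_iff:
  fixes u v x y :: real
  assumes "0 < u" "0 < v" "0 < x" "0 < y"
  shows "(x / y) powr p \<le> u / v \<longleftrightarrow> p * (ln x - ln y) \<le> ln u - ln v"
    and "u / v \<le> (x / y) powr p \<longleftrightarrow> ln u - ln v \<le> p * (ln x - ln y)"
proof -
  have "(x / y) powr p = exp (p * (ln x - ln y))" "u / v = exp (ln u - ln v)"
    using assms by (simp_all add: powr_def ln_div exp_diff)
  then show "(x / y) powr p \<le> u / v \<longleftrightarrow> p * (ln x - ln y) \<le> ln u - ln v"
    "u / v \<le> (x / y) powr p \<longleftrightarrow> ln u - ln v \<le> p * (ln x - ln y)"
    by simp_all
qed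

text \<open>Passing to logarithms enlarges distances on \<open>{c..}\<close> by at most the factor
  \<open>1 / c\<close>, from \<open>ln u - ln v \<le> (u - v) / v\<close>.\<close>

lemma abs_ln_diff_le:
  fixes c u v :: real
  assumes "0 < c" "c \<le> u" "c \<le> v"
  shows "\<bar>ln u - ln v\<bar> \<le> \<bar>u - v\<bar> / c"
proof -
  have *: "ln u - ln v \<le> \<bar>u - v\<bar> / c" if "c \<le> u" "c \<le> v" for u v
  proof -
    have "ln u - ln v \<le> (u - v) / v" using ln_diff_le[of u v] that assms(1) by linarith
    also have "\<dots> \<le> \<bar>u - v\<bar> / c" using that assms(1) by (intro frac_le) auto
    finally show ?thesis .
  qed
  show ?thesis using *[OF assms(2,3)] *[OF assms(3,2)] by (simp add: abs_minus_commute abs_le_iff)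
qed

text \<open>The way back from logarithms costs at most the factor \<open>d\<close>, by the same
  tangent inequality with the roles of the points exchanged.\<close>

lemma abs_diff_le_ln:
  fixes d u v :: real
  assumes "0 < u" "0 < v" "u \<le> d" "v \<le> d"
  shows "\<bar>u - v\<bar> \<le> d * \<bar>ln u - ln v\<bar>"
proof -
  have *: "u - v \<le> d * \<bar>ln u - ln v\<bar>" if "0 < u" "0 < v" "u \<le> d" for u v
  proof -
    have "u - v \<le> u * (ln u - ln v)"
      using ln_diff_le[of v u] that by (simp add: field_simps)
    also have "\<dots> \<le> u * \<bar>ln u - ln v\<bar>" using that by (intro mult_left_mono) auto
    also have "\<dots> \<le> d * \<bar>ln u - ln v\<bar>" using that by (intro mult_right_mono) auto
    finally show ?thesis .
  qed
  show ?thesis using *[OF assms(1,2,3)] *[OF assms(2,1,4)] by (simp add: abs_minus_commute abs_le_iff)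
qed

section \<open>The classes \<open>\<G>\<close> and the equation under the change of
  coordinate\<close>

lemma exp_mem_Icc: "0 < c \<Longrightarrow> 0 < d \<Longrightarrow> exp t \<in> {c..d} \<longleftrightarrow> t \<in> {ln c..ln d}" for c d t :: real
  using ln_le_cancel_iff[of c "exp t"] ln_le_cancel_iff[of "exp t" d] by simp

lemma \<G>_subset: "\<G> c d p q \<subseteq> cont_self_maps {c..d}"
  unfolding \<G>_def by blast

lemma \<G>_PiE: "g \<in> \<G> c d p q \<Longrightarrow> g \<in> {c..d} \<rightarrow>\<^sub>E {c..d}"
  unfolding \<G>_def cont_self_maps_def by blast

lemma \<G>_mem: "g \<in> \<G> c d p q \<Longrightarrow> x \<in> {c..d} \<Longrightarrow> g x \<in> {c..d}"
  by (rule PiE_mem[OF \<G>_PiE])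

lemma \<G>_eqI:
  assumes "f \<in> \<G> c d p q" "g \<in> \<G> c d p' q'" "\<And>x. x \<in> {c..d} \<Longrightarrow> f x = g x"
  shows "f = g"
  using assms(3) by (rule PiE_ext[OF \<G>_PiE[OF assms(1)] \<G>_PiE[OF assms(2)]])

definition ln_conj :: "(real \<Rightarrow> real) \<Rightarrow> real \<Rightarrow> real" where
  "ln_conj g t = ln (g (exp t))"

lemma ln_conj_slope_maps:
  assumes "0 < c" "c < d" and g: "g \<in> \<G> c d p q"
  shows "ln_conj g \<in> slope_maps (ln c) (ln d) p q"
proof -
  have E: "exp t \<in> {c..d}" if "t \<in> {ln c..ln d}" for t
    using that assms(1,2) by (subst exp_mem_Icc) auto
  have gE: "g (exp t) \<in> {c..d}" if "t \<in> {ln c..ln d}" for t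
    by (rule \<G>_mem[OF g E[OF that]])
  show ?thesis
    unfolding slope_maps_def
  proof (intro CollectI conjI ballI impI Pi_I)
    show "ln_conj g (ln c) = ln c" "ln_conj g (ln d) = ln d"
      using g assms(1,2) by (auto simp: \<G>_def ln_conj_def)
    show "ln_conj g t \<in> {ln c..ln d}" if "t \<in> {ln c..ln d}" for t
      using gE[OF that] assms(1) by (auto simp: ln_conj_def)
    fix s t assume st: "s \<in> {ln c..ln d}" "t \<in> {ln c..ln d}" "t \<le> s"
    have "(exp s / exp t) powr p \<le> g (exp s) / g (exp t)"
      "g (exp s) / g (exp t) \<le> (exp s / exp t) powr q"
      using g E[OF st(1)] E[OF st(2)] st(3) unfolding \<G>_def by auto
    then show "p * (s - t) \<le> ln_conj g s - ln_conj g t" "ln_conj g s - ln_conj g t \<le> q * (s - t)"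
      using gE[OF st(1)] gE[OF st(2)] assms(1) by (simp_all add: powr_ratio_le_iff ln_conj_def)
  qed
qed

text \<open>Inverse of the coordinate change. Members of \<open>\<G>\<close> are extensional, so the
  witness is restricted to \<open>{c..d}\<close> and gives back \<open>h\<close> only on the
  interval.\<close>

lemma exp_conj_\<G>:
  assumes "0 < c" "c < d" and h: "h \<in> slope_maps (ln c) (ln d) p q"
  obtains g where "g \<in> \<G> c d p q" "\<And>t. t \<in> {ln c..ln d} \<Longrightarrow> ln_conj g t = h t"
proof
  let ?g = "restrict (\<lambda>x. exp (h (ln x))) {c..d}"
  have E: "exp t \<in> {c..d} \<longleftrightarrow> t \<in> {ln c..ln d}" for t
    using assms(1,2) by (intro exp_mem_Icc) auto
  have lnE: "ln x \<in> {ln c..ln d}" if "x \<in> {c..d}" for x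
    using that assms(1,2) by auto
  have gE: "exp (h (ln x)) \<in> {c..d}" if "x \<in> {c..d}" for x
    using slope_mapsD(1)[OF h lnE[OF that]] E by blast
  show "ln_conj ?g t = h t" if "t \<in> {ln c..ln d}" for t
    using that E[of t] by (simp add: ln_conj_def del: atLeastAtMost_iff)
  show "?g \<in> \<G> c d p q"
    unfolding \<G>_def cont_self_maps_def
  proof (intro CollectI conjI ballI impI)
    show "?g \<in> {c..d} \<rightarrow>\<^sub>E {c..d}" using gE by auto
    have "continuous_on {c..d} (\<lambda>x. exp (h (ln x)))"
      using assms(1) lnE
      by (intro continuous_intros continuous_on_compose2[OF slope_maps_continuous[OF h]]) auto
    then show "continuous_on {c..d} ?g"
      by (rule continuous_on_eq) simp
    show "?g c = c" "?g d = d" using slope_mapsD(2,3)[OF h] assms(1,2) by auto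
    fix x y assume xy: "x \<in> {c..d}" "y \<in> {c..d}" "y \<le> x"
    have "ln y \<le> ln x" using xy assms(1) by simp
    then show "(x / y) powr p \<le> ?g x / ?g y" "?g x / ?g y \<le> (x / y) powr q"
      using slope_mapsD(4,5)[OF h lnE[OF xy(1)] lnE[OF xy(2)]] xy assms(1)
      by (simp_all add: powr_ratio_le_iff)
  qed
qed

text \<open>On the interval \<open>exp\<close> intertwines \<open>ln_conj g\<close> with
  \<open>g\<close>, since \<open>g\<close> has positive values. The second conjunct keeps the orbit
  inside the interval for the induction.\<close>

lemma funpow_exp:
  assumes "0 < c" "c < d" "g \<in> \<G> c d p q" "t \<in> {ln c..ln d}"
  shows "(g ^^ k) (exp t) = exp ((ln_conj g ^^ k) t) \<and> (ln_conj g ^^ k) t \<in> {ln c..ln d}"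
proof (induction k)
  case (Suc k)
  let ?s = "(ln_conj g ^^ k) t"
  have "exp ?s \<in> {c..d}" using Suc assms(1,2) by (subst exp_mem_Icc) auto
  then have "0 < g (exp ?s)" using \<G>_mem[OF assms(3)] assms(1) by fastforce
  then have "g (exp ?s) = exp (ln_conj g ?s)" by (simp add: ln_conj_def)
  then show ?case
    using Suc slope_mapsD(1)[OF ln_conj_slope_maps[OF assms(1-3)], of ?s] by simp
qed (use assms in simp)

text \<open>All values involved are positive, so taking logarithms loses nothing: the product
  becomes a sum and the exponents \<open>lam k\<close> become factors.\<close>

lemma solves_iter_eq_ln_iff:
  assumes "0 < c" "c < d" and g: "g \<in> \<G> c d p q" and G: "G \<in> \<G> c d p' q'"
    and \<psi>: "\<And>k x. k \<in> {1..n} \<Longrightarrow> x \<in> {c..d} \<Longrightarrow> \<psi> k x = x"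
    and \<Xi>: "\<And>k. k \<in> {1..n} \<Longrightarrow> \<Xi> k \<in> \<G> c d (l k) (L k)"
    and \<Psi>: "\<And>k x. k \<in> {1..n} \<Longrightarrow> x \<in> {c..d} \<Longrightarrow> \<Psi> k x = \<Xi> k x powr lam k"
  shows "solves_iter_eq {c..d} n \<Psi> \<psi> G g \<longleftrightarrow>
    (\<forall>t\<in>{ln c..ln d}. (\<Sum>k = 1..n. lam k * ln_conj (\<Xi> k) ((ln_conj g ^^ k) t)) = ln_conj G t)"
proof -
  have E: "exp t \<in> {c..d} \<longleftrightarrow> t \<in> {ln c..ln d}" for t
    using assms(1,2) by (intro exp_mem_Icc) auto
  have img: "{c..d} = exp ` {ln c..ln d}"
  proof (intro set_eqI iffI)
    fix x assume x: "x \<in> {c..d}"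
    then have "x = exp (ln x)" using assms(1) by simp
    then show "x \<in> exp ` {ln c..ln d}" using x E by (metis imageI)
  qed (use E in blast)
  have "(\<Prod>k = 1..n. \<Psi> k ((g ^^ k) (\<psi> k (exp t)))) = G (exp t) \<longleftrightarrow>
      (\<Sum>k = 1..n. lam k * ln_conj (\<Xi> k) ((ln_conj g ^^ k) t)) = ln_conj G t"
    if t: "t \<in> {ln c..ln d}" for t
  proof -
    have "(\<Prod>k = 1..n. \<Psi> k ((g ^^ k) (\<psi> k (exp t)))) =
        (\<Prod>k = 1..n. exp (lam k * ln_conj (\<Xi> k) ((ln_conj g ^^ k) t)))"
    proof (rule prod.cong)
      fix k assume k: "k \<in> {1..n}"
      let ?s = "(ln_conj g ^^ k) t"
      have s: "(g ^^ k) (exp t) = exp ?s" "exp ?s \<in> {c..d}"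
        using funpow_exp[OF assms(1-3) t, of k] E by auto
      have "0 < \<Xi> k (exp ?s)" using \<G>_mem[OF \<Xi>[OF k] s(2)] assms(1) by auto
      then show "\<Psi> k ((g ^^ k) (\<psi> k (exp t))) = exp (lam k * ln_conj (\<Xi> k) ?s)"
        using \<psi>[OF k, of "exp t"] \<Psi>[OF k s(2)] s(1) E t by (simp add: powr_def ln_conj_def)
    qed simp
    also have "\<dots> = exp (\<Sum>k = 1..n. lam k * ln_conj (\<Xi> k) ((ln_conj g ^^ k) t))"
      by (simp add: exp_sum)
    finally have prod: "(\<Prod>k = 1..n. \<Psi> k ((g ^^ k) (\<psi> k (exp t)))) = \<dots>" .
    have "0 < G (exp t)" using \<G>_mem[OF G] E t assms(1) by fastforce
    then have "G (exp t) = exp (ln_conj G t)" by (simp add: ln_conj_def)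
    then show ?thesis unfolding prod by simp
  qed
  then show ?thesis unfolding solves_iter_eq_def img by simp
qed

section \<open>Lipschitz maps for the uniform distance\<close>

lemma unif_dist_upper:
  assumes "A \<subseteq> cont_self_maps {c..d}" "f \<in> A" "g \<in> A" "x \<in> {c..d}"
  shows "\<bar>f x - g x\<bar> \<le> unif_dist {c..d} A f g"
proof -
  have "\<bar>f y - g y\<bar> \<le> d - c" if "y \<in> {c..d}" for y
  proof -
    have "f y \<in> {c..d}" "g y \<in> {c..d}"
      using assms(1-3) that unfolding cont_self_maps_def by blast+
    then show ?thesis by auto
  qed
  then have "bdd_above ((\<lambda>x. \<bar>f x - g x\<bar>) ` {c..d})" by (rule bdd_aboveI2)
  then show ?thesis
    using cSUP_upper[OF assms(4)] assms(2,3) by (simp add: unif_dist_def unif_norm_def)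
qed

lemma unif_dist_least:
  assumes "c \<le> d" "f \<in> A" "g \<in> A" "\<And>x. x \<in> {c..d} \<Longrightarrow> \<bar>f x - g x\<bar> \<le> e"
  shows "unif_dist {c..d} A f g \<le> e"
proof -
  have "(SUP x\<in>{c..d}. \<bar>f x - g x\<bar>) \<le> e"
    by (rule cSUP_least) (use assms(1,4) in auto)
  then show ?thesis using assms(2,3) by (simp add: unif_dist_def unif_norm_def)
qed

text \<open>In \<open>Lip\<close>, \<open>e\<close> is any pointwise bound; taking it to be the
  uniform distance of \<open>f\<close> and \<open>g\<close> gives a Lipschitz estimate with constant
  \<open>C\<close>, and \<open>\<epsilon> / C\<close> answers \<open>\<epsilon>\<close>.\<close>

lemma continuous_map_unif_LipschitzI:
  assumes "c \<le> d" and AB: "A \<subseteq> cont_self_maps {c..d}" "B \<subseteq> cont_self_maps {c..d}"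
    and F: "\<And>f. f \<in> A \<Longrightarrow> F f \<in> B"
    and Lip: "\<And>f g e x. f \<in> A \<Longrightarrow> g \<in> A \<Longrightarrow> (\<And>y. y \<in> {c..d} \<Longrightarrow> \<bar>f y - g y\<bar> \<le> e) \<Longrightarrow> x \<in> {c..d}
      \<Longrightarrow> \<bar>F f x - F g x\<bar> \<le> C * e"
    and "0 < C"
  shows "continuous_map (unif_topology {c..d} A) (unif_topology {c..d} B) F"
proof -
  interpret A: Metric_space A "unif_dist {c..d} A"
    by (rule Metric_space_unif_dist[OF assms(1) AB(1)])
  interpret B: Metric_space B "unif_dist {c..d} B"
    by (rule Metric_space_unif_dist[OF assms(1) AB(2)])
  have le: "unif_dist {c..d} B (F f) (F g) \<le> C * unif_dist {c..d} A f g" if "f \<in> A" "g \<in> A" for f g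
    by (intro unif_dist_least F Lip unif_dist_upper that AB(1) assms(1))
  show ?thesis
    unfolding unif_topology_def A.metric_continuous_map[OF B.Metric_space_axioms]
  proof (intro conjI ballI allI impI)
    show "F ` A \<subseteq> B" using F by blast
    fix f and \<epsilon> :: real assume f: "f \<in> A" and "0 < \<epsilon>"
    have "unif_dist {c..d} B (F f) (F g) < \<epsilon>" if "g \<in> A" "unif_dist {c..d} A f g < \<epsilon> / C" for g
      using le[OF f that(1)] that(2) \<open>0 < C\<close> by (simp add: field_simps)
    then show "\<exists>\<delta>>0. \<forall>g. g \<in> A \<and> unif_dist {c..d} A f g < \<delta> \<longrightarrow> unif_dist {c..d} B (F f) (F g) < \<epsilon>"
      using \<open>0 < \<epsilon>\<close> \<open>0 < C\<close> by (intro exI[of _ "\<epsilon> / C"]) auto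
  qed
qed

section \<open>Well-posedness of the multiplicative equation\<close>

theorem theorem1:
  fixes c d \<delta> M K K\<^sub>0 K\<^sub>1 :: real
    and n :: nat
    and lam l L :: "nat \<Rightarrow> real"
    and \<psi> \<Xi> \<Psi> :: "nat \<Rightarrow> real \<Rightarrow> real"
  assumes "0 < c" and "c < d"
    and "1 \<le> n"
    and "0 < lam 1" and "lam 1 < 1"
    and "\<And>k. k \<in> {2..n} \<Longrightarrow> 0 \<le> lam k"
    and "(\<Sum>k = 1..n. lam k) = 1"
    and "\<And>k x. k \<in> {1..n} \<Longrightarrow> x \<in> {c..d} \<Longrightarrow> \<psi> k x = x"
    and "\<And>k. k \<in> {1..n} \<Longrightarrow> 0 \<le> l k \<and> l k \<le> L k"
    and "\<And>k. k \<in> {1..n} \<Longrightarrow> \<Xi> k \<in> \<G> c d (l k) (L k)"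
    and "\<And>k x. k \<in> {1..n} \<Longrightarrow> x \<in> {c..d} \<Longrightarrow> \<Psi> k x = \<Xi> k x powr lam k"
    and "0 < \<delta>" and "\<delta> < 1" and "1 < M"
    and "K\<^sub>0 = (\<Sum>k = 1..n. lam k * l k * \<delta> ^ (k - 1))"
    and "K\<^sub>1 = (\<Sum>k = 1..n. lam k * L k * M ^ (k - 1))"
    and "K = lam 1 * l 1 -
           (\<Sum>k = 2..n. lam k * (L k * ((M ^ (k - 1) - 1) / (M - 1)) - l k * \<delta> ^ (k - 1)))"
    and "K > 0"
  shows "(\<forall>G \<in> \<G> c d (K\<^sub>1 * \<delta>) (K\<^sub>0 * M).
            \<exists>!g. g \<in> \<G> c d \<delta> M \<and> solves_iter_eq {c..d} n \<Psi> \<psi> G g) \<and>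
         continuous_map
           (unif_topology {c..d} (\<G> c d (K\<^sub>1 * \<delta>) (K\<^sub>0 * M)))
           (unif_topology {c..d} (\<G> c d \<delta> M))
           (\<lambda>G. THE g. g \<in> \<G> c d \<delta> M \<and> solves_iter_eq {c..d} n \<Psi> \<psi> G g)"
proof -
  note [simp del] = atLeastAtMost_iff
  \<comment> \<open>With this choice \<open>K > 0\<close> reads \<open>S < K\<^sub>0\<close>, and
    the stability constant \<open>K\<^sub>0 - S\<close> is \<open>K\<close>.\<close>
  define S where S_K: "S = K\<^sub>0 - K"
  let ?A = "\<G> c d (K\<^sub>1 * \<delta>) (K\<^sub>0 * M)" and ?B = "\<G> c d \<delta> M"
  let ?I = "{ln c..ln d}"
  note cd = assms(1,2)
  note pos = assms(12-14)
  have ln_cd: "ln c < ln d" using cd by simp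
  have split: "(\<Sum>k = 1..n. f k) = f 1 + (\<Sum>k = 2..n. f k)" for f :: "nat \<Rightarrow> real"
    using sum.atLeast_Suc_atMost[OF \<open>1 \<le> n\<close>, of f] by (simp add: numeral_2_eq_2)
  have geom: "(M ^ k - 1) / (M - 1) = (\<Sum>i<k. M ^ i)" for k
    using geometric_sum[of M k] pos by simp
  \<comment> \<open>In \<open>K\<^sub>0 - K\<close> all terms with \<open>l k\<close> cancel, the
    first because \<open>\<delta> ^ 0 = 1\<close>. The added term \<open>k = 1\<close> on the right
    has an empty inner sum.\<close>
  have S_eq: "S = (\<Sum>k = 1..n. lam k * (L k * (\<Sum>i<k - 1. M ^ i)))"
    unfolding S_K assms(15,17) split geom
    by (simp add: right_diff_distrib sum_subtractf mult.assoc)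
  interpret additive_iter_eq "ln c" "ln d" \<delta> M n lam l L "\<lambda>k. ln_conj (\<Xi> k)" K\<^sub>0 K\<^sub>1 S
  proof
    show "0 \<le> lam k" if "k \<in> {1..n}" for k
      using that assms(4,6) by (cases "k = 1") (auto simp: atLeastAtMost_iff)
    show "0 \<le> l k" "l k \<le> L k" if "k \<in> {1..n}" for k
      using assms(9)[OF that] by auto
    show "ln_conj (\<Xi> k) \<in> slope_maps (ln c) (ln d) (l k) (L k)" if "k \<in> {1..n}" for k
      by (rule ln_conj_slope_maps[OF cd assms(10)[OF that]])
    show "K\<^sub>0 = (\<Sum>k = 1..n. lam k * (l k * \<delta> ^ (k - 1)))"
      "K\<^sub>1 = (\<Sum>k = 1..n. lam k * (L k * M ^ (k - 1)))"
      unfolding assms(15,16) by (simp_all add: mult.assoc)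
    show "S < K\<^sub>0" using assms(18) by (simp add: S_K)
  qed (use pos ln_cd assms(7) S_eq in auto)
  note slope = ln_conj_slope_maps[OF cd]
  have solves_iff: "solves_iter_eq {c..d} n \<Psi> \<psi> G g \<longleftrightarrow>
      (\<forall>t\<in>?I. P (ln_conj g) (ln_conj g t) = ln_conj G t)" if "G \<in> ?A" "g \<in> ?B" for G g
    unfolding P_apply
    by (rule solves_iter_eq_ln_iff[OF cd that(2,1) assms(8,10,11)])
  \<comment> \<open>The constant collects \<open>1 / c\<close> for taking logarithms of the
    right-hand sides, \<open>1 / K\<close> from \<open>stability\<close> and \<open>d\<close> for
    the way back. The estimate yields both uniqueness and continuity.\<close>
  have Lip: "\<bar>g x - h x\<bar> \<le> d / (c * K) * e"
    if G: "G \<in> ?A" "H \<in> ?A" and gh: "g \<in> ?B" "h \<in> ?B"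
      and sol: "solves_iter_eq {c..d} n \<Psi> \<psi> G g" "solves_iter_eq {c..d} n \<Psi> \<psi> H h"
      and e: "\<And>y. y \<in> {c..d} \<Longrightarrow> \<bar>G y - H y\<bar> \<le> e" and x: "x \<in> {c..d}" for G H g h e x
  proof -
    have *: "\<bar>P (ln_conj g) (ln_conj g t) - P (ln_conj h) (ln_conj h t)\<bar> \<le> e / c" if t: "t \<in> ?I" for t
    proof -
      have E: "exp t \<in> {c..d}" using t cd by (subst exp_mem_Icc) auto
      have "\<bar>ln_conj G t - ln_conj H t\<bar> \<le> \<bar>G (exp t) - H (exp t)\<bar> / c"
        using \<G>_mem[OF G(1) E] \<G>_mem[OF G(2) E] cd unfolding ln_conj_def
        by (intro abs_ln_diff_le) (auto simp: atLeastAtMost_iff)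
      also have "\<dots> \<le> e / c" using e[OF E] cd by (simp add: divide_right_mono)
      finally show ?thesis
        using sol t solves_iff[OF G(1) gh(1)] solves_iff[OF G(2) gh(2)] by simp
    qed
    have lnx: "ln x \<in> ?I" and x0: "0 < x" using x cd by (auto simp: atLeastAtMost_iff)
    have "K * \<bar>ln_conj g (ln x) - ln_conj h (ln x)\<bar> \<le> e / c"
      using stability[OF slope[OF gh(1)] slope[OF gh(2)] * lnx] by (simp add: S_K)
    then have "\<bar>ln (g x) - ln (h x)\<bar> \<le> e / (c * K)"
      using x0 assms(18) cd by (simp add: ln_conj_def field_simps)
    then have "d * \<bar>ln (g x) - ln (h x)\<bar> \<le> d * (e / (c * K))"
      using cd by (intro mult_left_mono) auto
    moreover have "\<bar>g x - h x\<bar> \<le> d * \<bar>ln (g x) - ln (h x)\<bar>"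
      using \<G>_mem[OF gh(1) x] \<G>_mem[OF gh(2) x] cd
      by (intro abs_diff_le_ln) (auto simp: atLeastAtMost_iff)
    ultimately show ?thesis by simp
  qed
  have ex1: "\<exists>!g. g \<in> ?B \<and> solves_iter_eq {c..d} n \<Psi> \<psi> G g" if G: "G \<in> ?A" for G
  proof (rule ex_ex1I)
    obtain h where h: "h \<in> slope_maps (ln c) (ln d) \<delta> M"
      "\<And>t. t \<in> ?I \<Longrightarrow> P h (h t) = ln_conj G t"
      using existence[OF slope[OF G]] by blast
    obtain g where g: "g \<in> ?B" "\<And>t. t \<in> ?I \<Longrightarrow> ln_conj g t = h t"
      using exp_conj_\<G>[OF cd h(1)] by blast
    \<comment> \<open>\<open>ln_conj g\<close> and \<open>h\<close> agree only on the interval, so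
      they cannot be substituted for each other; \<open>P_diff\<close> with error 0 gives equality
      of the sums.\<close>
    have "P (ln_conj g) u = P h u" if "u \<in> ?I" for u
      using P_diff[OF slope[OF g(1)] h(1) _ that, of 0] g(2) by simp
    then have "\<forall>t\<in>?I. P (ln_conj g) (ln_conj g t) = ln_conj G t"
      using g(2) h(2) slope_mapsD(1)[OF h(1)] by simp
    then show "\<exists>g. g \<in> ?B \<and> solves_iter_eq {c..d} n \<Psi> \<psi> G g"
      using solves_iff[OF G g(1)] g(1) by blast
    fix f g assume fg: "f \<in> ?B \<and> solves_iter_eq {c..d} n \<Psi> \<psi> G f"
      "g \<in> ?B \<and> solves_iter_eq {c..d} n \<Psi> \<psi> G g"
    \<comment> \<open>Two solutions for the same \<open>G\<close> have data at distance
      \<open>e = 0\<close>.\<close>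
    then have "f x = g x" if "x \<in> {c..d}" for x
      using Lip[OF G G, of f g 0 x] that by simp
    then show "f = g" using fg \<G>_eqI by blast
  qed
  let ?F = "\<lambda>G. THE g. g \<in> ?B \<and> solves_iter_eq {c..d} n \<Psi> \<psi> G g"
  \<comment> \<open>Unique existence makes the definite description an actual solution, so
    \<open>Lip\<close> applies to it.\<close>
  have F: "?F G \<in> ?B" "solves_iter_eq {c..d} n \<Psi> \<psi> G (?F G)" if "G \<in> ?A" for G
    using theI'[OF ex1[OF that]] by blast+
  have "continuous_map (unif_topology {c..d} ?A) (unif_topology {c..d} ?B) ?F"
  proof (rule continuous_map_unif_LipschitzI[OF _ \<G>_subset \<G>_subset])
    show "\<bar>?F G x - ?F H x\<bar> \<le> d / (c * K) * e"
      if "G \<in> ?A" "H \<in> ?A" "\<And>y. y \<in> {c..d} \<Longrightarrow> \<bar>G y - H y\<bar> \<le> e" "x \<in> {c..d}" for G H e x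
      using Lip[OF that(1,2) F(1)[OF that(1)] F(1)[OF that(2)] F(2)[OF that(1)] F(2)[OF that(2)]]
        that(3,4) by blast
    show "0 < d / (c * K)" "c \<le> d" using cd assms(18) by auto
  qed (rule F(1))
  then show ?thesis using ex1 by blast
qed

end
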